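(* Let $P=\{x_1,\dots,x_d\}$ be a finite poset which is not a chain. Then each of the order polytope $\mathcal{O}(P)$ and the chain polytope $\mathcal{C}(P)$ possesses a separating hyperplane.
   Context: The order polytope $\mathcal{O}(P)\subset\mathbb{R}^d$ is the set of $(a_1,\dots,a_d)$ with $0\le a_i\le 1$ for all $i$ and $a_i\ge a_j$ whenever $x_i\le x_j$ in $P$. A maximal chain of $P$ is a chain $x_{i_1}<\cdots<x_{i_k}$ in which each element covers the previous one, $x_{i_1}$ is minimal and $x_{i_k}$ is maximal. The chain polytope $\mathcal{C}(P)\subset\mathbb{R}^d$ is the set of $(a_1,\dots,a_d)$ with $a_i\ge 0$ for all $i$ and $a_{i_1}+\cdots+a_{i_k}\le 1$ for every maximal chain of $P$. For a convex polytope $\mathcal{P}$ and a hyperplane $\mathcal{H}$ with closed half-spaces $\mathcal{H}^{(+)},\mathcal{H}^{(-)}$ ($\mathcal{H}^{(+)}\cap\mathcal{H}^{(-)}=\mathcal{H}$), $\mathcal{H}$ is a separating hyperplane of $\mathcal{P}$ if $\mathcal{H}$ meets the (relative) interior of $\mathcal{P}$ and every vertex of each of $\mathcal{P}\cap\mathcal{H}^{(+)}$ and $\mathcal{P}\cap\mathcal{H}^{(-)}$ is a vertex of $\mathcal{P}$. *)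

theory Defs
  imports "HOL-Analysis.Analysis"
begin

text \<open>
  A poset \<open>P = {x\<^sub>1, \<dots>, x\<^sub>d}\<close> is given by a partial order \<open>r\<close> on the finite index type \<open>'n\<close>
  (so \<open>d = CARD('n)\<close>), where \<open>(i, j) \<in> r\<close> means \<open>x\<^sub>i \<le> x\<^sub>j\<close>.  Its polytopes live in \<open>real ^ 'n\<close>.
\<close>

definition order_polytope :: "('n::finite) rel \<Rightarrow> (real ^ 'n) set" where
  "order_polytope r =
     {a. (\<forall>i. 0 \<le> a $ i \<and> a $ i \<le> 1) \<and> (\<forall>i j. (i, j) \<in> r \<longrightarrow> a $ i \<ge> a $ j)}"

definition covered_by :: "'n rel \<Rightarrow> 'n \<Rightarrow> 'n \<Rightarrow> bool" where
  "covered_by r i j \<longleftrightarrow> (i, j) \<in> r \<and> i \<noteq> j \<and>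
     \<not> (\<exists>k. k \<noteq> i \<and> k \<noteq> j \<and> (i, k) \<in> r \<and> (k, j) \<in> r)"

definition maximal_chain :: "'n rel \<Rightarrow> 'n list \<Rightarrow> bool" where
  "maximal_chain r xs \<longleftrightarrow> xs \<noteq> [] \<and> successively (covered_by r) xs \<and>
     (\<forall>k. (k, hd xs) \<in> r \<longrightarrow> k = hd xs) \<and> (\<forall>k. (last xs, k) \<in> r \<longrightarrow> k = last xs)"

definition chain_polytope :: "('n::finite) rel \<Rightarrow> (real ^ 'n) set" where
  "chain_polytope r =
     {a. (\<forall>i. 0 \<le> a $ i) \<and> (\<forall>xs. maximal_chain r xs \<longrightarrow> (\<Sum>i\<leftarrow>xs. a $ i) \<le> 1)}"

text \<open>The vertices of a polytope are its extreme points.\<close>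

definition separating_hyperplane :: "'a::euclidean_space set \<Rightarrow> 'a set \<Rightarrow> bool" where
  "separating_hyperplane S H \<longleftrightarrow>
     (\<exists>c b. c \<noteq> 0 \<and> H = {x. c \<bullet> x = b} \<and>
        H \<inter> rel_interior S \<noteq> {} \<and>
        (\<forall>v. v extreme_point_of (S \<inter> {x. c \<bullet> x \<ge> b}) \<longrightarrow> v extreme_point_of S) \<and>
        (\<forall>v. v extreme_point_of (S \<inter> {x. c \<bullet> x \<le> b}) \<longrightarrow> v extreme_point_of S))"

end

theory Submission
  imports Defs
begin

text \<open>
  The hyperplane is \<open>a\<^sub>i = a\<^sub>j\<close> for an incomparable pair \<open>i, j\<close>.  It cuts the order polytope into
  the order polytopes of two larger relations, and for every relation the extreme points are
  0/1 vectors: a level set \<open>{k. a\<^sub>k = t}\<close> with \<open>0 < t < 1\<close> can be moved up and down.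

  For the chain polytope the pair is chosen minimal, so that \<open>i\<close> and \<open>j\<close> have the same strict lower
  bounds.  Stanley's transfer map writes a point as \<open>c\<^sub>k = b\<^sub>k - max\<^sub>l\<^sub><\<^sub>k b\<^sub>l\<close> with \<open>b\<close>
  order preserving, so that \<open>c\<^sub>i - c\<^sub>j = b\<^sub>i - b\<^sub>j\<close>.  The transfer map is linear along the level-set
  perturbations of \<open>b\<close>, hence the extreme points of both pieces are again 0/1 vectors, and every
  0/1 vector in a subset of the unit cube is extreme in it.
\<close>

subsection \<open>Extreme points and 0/1 vectors\<close>

text \<open>Each coordinate of \<open>v\<close> sits at an end of [0,1], and a proper convex
  combination of two numbers in [0,1] reaches an end only if both numbers equal it.\<close>

lemma extreme_point_of_01_vector:
  fixes S :: "(real ^ 'n::finite) set"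
  assumes cube: "\<And>x k. x \<in> S \<Longrightarrow> 0 \<le> x $ k \<and> x $ k \<le> 1"
    and "v \<in> S" and v: "\<And>k. v $ k = 0 \<or> v $ k = 1"
  shows "v extreme_point_of S"
  unfolding extreme_point_of_def
proof (intro conjI ballI notI)
  show "v \<in> S" by fact
next
  fix a b assume ab: "a \<in> S" "b \<in> S" and "v \<in> open_segment a b"
  then obtain u where "a \<noteq> b" and u: "0 < u" "u < 1" and vu: "v = (1 - u) *\<^sub>R a + u *\<^sub>R b"
    by (auto simp: in_segment)
  have "a $ k = b $ k" for k
  proof -
    have k: "v $ k = (1 - u) * a $ k + u * b $ k" using vu by simp
    have a: "0 \<le> a $ k" "a $ k \<le> 1" and b: "0 \<le> b $ k" "b $ k \<le> 1"
      using cube ab by auto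
    show ?thesis using v[of k]
    proof
      assume "v $ k = 0"
      moreover have "0 \<le> (1 - u) * a $ k" "0 \<le> u * b $ k" using u a b by auto
      ultimately have "(1 - u) * a $ k = 0" "u * b $ k = 0" using k by linarith+
      then show ?thesis using u by auto
    next
      assume "v $ k = 1"
      then have "(1 - u) * (1 - a $ k) + u * (1 - b $ k) = 0"
        using k by (simp add: algebra_simps)
      moreover have "0 \<le> (1 - u) * (1 - a $ k)" "0 \<le> u * (1 - b $ k)" using u a b by auto
      ultimately have "(1 - u) * (1 - a $ k) = 0" "u * (1 - b $ k) = 0" by linarith+
      then show ?thesis using u by auto
    qed
  qed
  then show False using \<open>a \<noteq> b\<close> by (simp add: vec_eq_iff)
qed

lemma extreme_point_of_perturb_eq_0:
  fixes v d :: "'a::euclidean_space"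
  assumes "v extreme_point_of S" "v + d \<in> S" "v - d \<in> S"
  shows "d = 0"
proof (rule ccontr)
  assume "d \<noteq> 0"
  then have "v + d \<noteq> v - d"
    by (metis add_right_cancel diff_add_cancel add.assoc add_cancel_right_right
        scaleR_2 scaleR_eq_0_iff zero_neq_numeral)
  then have "midpoint (v + d) (v - d) \<in> open_segment (v + d) (v - d)"
    by (simp add: midpoint_in_open_segment)
  moreover have "midpoint (v + d) (v - d) = v"
    by (simp add: midpoint_def scaleR_2[symmetric])
  ultimately show False using assms by (auto simp: extreme_point_of_def)
qed

text \<open>A map on values rather than on points, so that it can be moved through a
  maximum.\<close>

definition bump :: "real \<Rightarrow> real \<Rightarrow> real \<Rightarrow> real" where
  "bump t e x = x + (if x = t then e else 0)"

text \<open>With \<open>e\<close> at most the distance from \<open>t\<close> to the other values in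
  \<open>V\<close>, the shifted level may meet a neighbouring value but never passes it.\<close>

lemma bump_mono_on_finite:
  fixes V :: "real set"
  assumes "finite V"
  obtains e where "e > 0" "mono_on V (bump t e)" "mono_on V (bump t (- e))"
proof -
  have "\<exists>e>0. \<forall>x\<in>V. x \<noteq> t \<longrightarrow> e \<le> \<bar>x - t\<bar>"
    using finite_set_avoid[OF assms, of t] by (auto simp: dist_real_def abs_minus_commute)
  then obtain e where e: "e > 0" "\<And>x. x \<in> V \<Longrightarrow> x \<noteq> t \<Longrightarrow> e \<le> \<bar>x - t\<bar>" by auto
  have "mono_on V (bump t s)" if "\<bar>s\<bar> \<le> e" for s
    using e(2) that unfolding mono_on_def bump_def by (smt (verit))
  then show thesis using that[of e] e(1) by auto
qed

lemma Max_image_mono_on: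
  assumes "finite X" "X \<noteq> {}" "mono_on V g" "X \<subseteq> V"
  shows "Max (g ` X) = g (Max X)"
proof (rule Max_eqI)
  show "finite (g ` X)" using assms by simp
  show "g (Max X) \<in> g ` X" using assms by simp
  show "y \<le> g (Max X)" if "y \<in> g ` X" for y
    using that assms by (auto intro!: mono_onD[OF assms(3)] intro: Max_in)
qed

subsection \<open>The order polytope\<close>

text \<open>Stated for arbitrary relations because it is applied to \<open>insert q r\<close>, which
  may fail to be transitive.\<close>

lemma extreme_point_of_order_polytope_01:
  assumes "v extreme_point_of order_polytope r"
  shows "v $ k = 0 \<or> v $ k = 1"
proof (rule ccontr)
  assume nk: "\<not> ?thesis"
  define t where "t = v $ k"
  \<comment> \<open>With 0 and 1 in \<open>V\<close>, both fixed by the bump, monotonicity on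
    \<open>V\<close> also keeps the moved coordinates within [0,1].\<close>
  define V where "V = range (($) v) \<union> {0, 1}"
  have "finite V" by (simp add: V_def)
  then obtain e where e: "e > 0" "mono_on V (bump t e)" "mono_on V (bump t (- e))"
    by (rule bump_mono_on_finite)
  have v: "v \<in> order_polytope r" using assms by (simp add: extreme_point_of_def)
  have bumped: "(\<chi> l. bump t s (v $ l)) \<in> order_polytope r" if "mono_on V (bump t s)" for s
  proof -
    have "bump t s 0 = 0" "bump t s 1 = 1" using nk by (auto simp: bump_def t_def)
    moreover have "bump t s x \<le> bump t s y" if "x \<in> V" "y \<in> V" "x \<le> y" for x y
      using mono_onD[OF \<open>mono_on V (bump t s)\<close>] that by auto
    moreover have "v $ l \<in> V" "0 \<in> V" "1 \<in> V" for l by (auto simp: V_def)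
    ultimately show ?thesis
      using v unfolding order_polytope_def by (simp, metis)
  qed
  define d where "d = (\<chi> l. if v $ l = t then e else 0)"
  have "v + d = (\<chi> l. bump t e (v $ l))" "v - d = (\<chi> l. bump t (- e) (v $ l))"
    by (auto simp: d_def bump_def vec_eq_iff)
  then have "d = 0"
    using extreme_point_of_perturb_eq_0[OF assms] bumped[OF e(2)] bumped[OF e(3)] by simp
  moreover have "d $ k = e" by (simp add: d_def t_def)
  ultimately show False using e(1) by simp
qed

text \<open>The number of lower bounds serves throughout as an integer height: as a measure for
  recursion, for extremal choices and for interior points.\<close>

lemma card_lower_bounds_strict_mono:
  fixes r :: "('n::finite) rel"
  assumes "partial_order_on UNIV r" "(k, l) \<in> r" "k \<noteq> l"
  shows "card {m. (m, k) \<in> r} < card {m. (m, l) \<in> r}"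
proof (rule psubset_card_mono)
  have "refl r" "trans r" "antisym r"
    using assms(1) by (auto simp: partial_order_on_def preorder_on_def)
  then show "{m. (m, k) \<in> r} \<subset> {m. (m, l) \<in> r}"
    using assms(2,3) by (auto dest: transD antisymD reflD)
qed simp

text \<open>Supplies a strictly monotone height that agrees at \<open>i\<close> and
  \<open>j\<close>, from which a point of the hyperplane in the interior of the order polytope is
  built.\<close>

lemma strict_mono_levelling_incomparable:
  fixes r :: "('n::finite) rel"
  assumes po: "partial_order_on UNIV r" and "(i, j) \<notin> r" "(j, i) \<notin> r"
  shows "\<exists>h :: 'n \<Rightarrow> nat. h i = h j \<and> (\<forall>k l. (k, l) \<in> r \<longrightarrow> k \<noteq> l \<longrightarrow> h k < h l)"
proof -
  have tr: "trans r" and rf: "refl r"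
    using po by (auto simp: partial_order_on_def preorder_on_def)
  define g where "g k = card {m. (m, k) \<in> r}" for k
  have g: "g k < g l" if "(k, l) \<in> r" "k \<noteq> l" for k l
    unfolding g_def by (rule card_lower_bounds_strict_mono[OF po that])
  have *: "\<exists>h :: 'n \<Rightarrow> nat. h i = h j \<and> (\<forall>k l. (k, l) \<in> r \<longrightarrow> k \<noteq> l \<longrightarrow> h k < h l)"
    if ij: "g i \<le> g j" "(i, j) \<notin> r" for i j
  proof -
    \<comment> \<open>All elements above \<open>i\<close> are lifted by the same amount. They form
      an up-set, so strict monotonicity survives; \<open>j\<close> is not among them and keeps its
      height, which \<open>i\<close> now attains.\<close>
    define h where "h k = g k + (if (i, k) \<in> r then g j - g i else 0)" for k
    have "h i = h j" using ij rf by (auto simp: h_def refl_on_def)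
    moreover have "h k < h l" if "(k, l) \<in> r" "k \<noteq> l" for k l
      using g[OF that] transD[OF tr _ that(1), of i] by (auto simp: h_def)
    ultimately show ?thesis by blast
  qed
  show ?thesis using *[of i j] *[of j i] assms(2,3) by (metis linear)
qed

lemma inner_axis_diff:
  fixes x :: "real ^ 'n::finite"
  shows "(axis i 1 - axis j 1) \<bullet> x = x $ i - x $ j"
  by (simp add: inner_diff_left inner_axis')

lemma axis_diff_nonzero: "i \<noteq> j \<Longrightarrow> (axis i 1 - axis j 1 :: real ^ 'n::finite) \<noteq> 0"
  by (simp add: axis_eq_axis)

lemma order_polytope_separating_hyperplane:
  fixes r :: "('n::finite) rel"
  assumes po: "partial_order_on UNIV r" and ij: "(i, j) \<notin> r" "(j, i) \<notin> r"
  shows "separating_hyperplane (order_polytope r) {x. (axis i 1 - axis j 1) \<bullet> x = 0}"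
proof -
  have "i \<noteq> j" using po ij by (auto simp: partial_order_on_def preorder_on_def refl_on_def)
  obtain h :: "'n \<Rightarrow> nat" where h: "h i = h j" "\<And>k l. (k, l) \<in> r \<Longrightarrow> k \<noteq> l \<Longrightarrow> h k < h l"
    using strict_mono_levelling_incomparable[OF assms] by blast
  define N where "N = Suc (Max (range h))"
  have hN: "h k < N" for k unfolding N_def by (simp add: less_Suc_eq_le)
  \<comment> \<open>Coordinates of the order polytope decrease along the order, hence the reversal.
    The added ones keep every value strictly between 0 and 1.\<close>
  define p :: "real ^ 'n" where "p = (\<chi> k. 1 - (real (h k) + 1) / (real N + 1))"
  \<comment> \<open>Finitely many strict inequalities give an open subset of the polytope, so
    membership in \<open>U\<close> suffices for the relative interior.\<close>
  define U :: "(real ^ 'n) set" where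
    "U = (\<Inter>k. {x. 0 < x $ k} \<inter> {x. x $ k < 1}) \<inter>
         (\<Inter>(k, l) \<in> r - Id. {x. x $ l < x $ k})"
  have "open U" unfolding U_def
    by (intro open_Int open_INT ballI)
      (auto intro!: open_Collect_less continuous_intros simp: split_beta)
  moreover have "U \<subseteq> order_polytope r"
  proof
    fix x assume "x \<in> U"
    then have x: "0 < x $ k" "x $ k < 1" "\<And>l. (k, l) \<in> r \<Longrightarrow> k \<noteq> l \<Longrightarrow> x $ l < x $ k" for k
      by (auto simp: U_def)
    then have "x $ l \<le> x $ k" if "(k, l) \<in> r" for k l
      using that by (cases "k = l") (auto intro: less_imp_le)
    then show "x \<in> order_polytope r" using x(1,2) by (simp add: order_polytope_def less_imp_le)
  qed
  ultimately have "U \<subseteq> rel_interior (order_polytope r)"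
    by (meson interior_maximal interior_subset_rel_interior subset_trans)
  moreover have "p \<in> U"
  proof -
    have "0 < p $ k" "p $ k < 1" for k
      using hN[of k] by (simp_all add: p_def)
    moreover have "p $ l < p $ k" if "(k, l) \<in> r" "k \<noteq> l" for k l
      using h(2)[OF that] by (simp add: p_def divide_strict_right_mono)
    ultimately show ?thesis by (auto simp: U_def)
  qed
  ultimately have "p \<in> rel_interior (order_polytope r)" by blast
  moreover have "p $ i - p $ j = 0" using h(1) by (simp add: p_def)
  moreover have "v extreme_point_of order_polytope r"
    if "v extreme_point_of order_polytope (insert q r)" for v q
  proof (rule extreme_point_of_01_vector)
    show "v $ k = 0 \<or> v $ k = 1" for k by (rule extreme_point_of_order_polytope_01[OF that])
    show "v \<in> order_polytope r"
      using that by (auto simp: extreme_point_of_def order_polytope_def)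
  qed (auto simp: order_polytope_def)
  moreover have "order_polytope r \<inter> {x. x $ i - x $ j \<ge> 0} = order_polytope (insert (i, j) r)"
    "order_polytope r \<inter> {x. x $ i - x $ j \<le> 0} = order_polytope (insert (j, i) r)"
    by (auto simp: order_polytope_def)
  ultimately show ?thesis
    unfolding separating_hyperplane_def
    by (intro exI[of _ "axis i 1 - axis j 1"] exI[of _ 0] conjI axis_diff_nonzero \<open>i \<noteq> j\<close> refl)
      (auto simp: inner_axis_diff)
qed

subsection \<open>The transfer map\<close>

text \<open>The inserted 0 covers minimal elements. For nonnegative order-preserving
  \<open>b\<close>, the maximum over all elements strictly below \<open>k\<close> equals the one
  over the elements that \<open>k\<close> covers, as in Stanley's map.\<close>

definition lower_max :: "'n rel \<Rightarrow> ('n::finite \<Rightarrow> real) \<Rightarrow> 'n \<Rightarrow> real" where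
  "lower_max r b k = Max (insert 0 (b ` {l. (l, k) \<in> r \<and> l \<noteq> k}))"

lemma lower_max_nonneg: "0 \<le> lower_max r b k"
  by (simp add: lower_max_def)

lemma lower_max_ge: "(l, k) \<in> r \<Longrightarrow> l \<noteq> k \<Longrightarrow> b l \<le> lower_max r b k"
  by (auto simp: lower_max_def)

lemma lower_max_cases:
  "lower_max r b k = 0 \<or> (\<exists>l. (l, k) \<in> r \<and> l \<noteq> k \<and> lower_max r b k = b l)"
proof -
  have "lower_max r b k \<in> insert 0 (b ` {l. (l, k) \<in> r \<and> l \<noteq> k})"
    unfolding lower_max_def by (rule Max_in) auto
  then show ?thesis by auto
qed

text \<open>A monotone map commutes with finite maxima, and fixing 0 takes care of the inserted
  value. This makes the transfer map follow a bump of \<open>b\<close> explicitly.\<close>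

lemma lower_max_comp:
  assumes "mono_on V g" "g 0 = 0" "0 \<in> V" "range b \<subseteq> V"
  shows "lower_max r (\<lambda>l. g (b l)) k = g (lower_max r b k)"
proof -
  let ?X = "insert 0 (b ` {l. (l, k) \<in> r \<and> l \<noteq> k})"
  have "Max (g ` ?X) = g (Max ?X)"
    using assms by (intro Max_image_mono_on[where V = V]) auto
  then show ?thesis using assms(2) by (simp add: lower_max_def image_image)
qed

lemma wf_strict_partial_order:
  fixes r :: "('n::finite) rel"
  assumes "partial_order_on UNIV r"
  shows "wf (r - Id)"
  by (rule wf_subset[OF wf_measure[of "\<lambda>k. card {m. (m, k) \<in> r}"]])
    (use assms in \<open>auto intro: card_lower_bounds_strict_mono\<close>)

text \<open>The equation determines \<open>b\<close> from the bottom up, since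
  \<open>lower_max r b k\<close> depends only on values strictly below \<open>k\<close>.\<close>

lemma ex_transfer_inverse:
  fixes r :: "('n::finite) rel"
  assumes "partial_order_on UNIV r"
  shows "\<exists>b. \<forall>k. b k = c k + lower_max r b k"
proof -
  let ?F = "\<lambda>f k. c k + lower_max r f k"
  let ?b = "wfrec (r - Id) ?F"
  have "?b k = c k + lower_max r ?b k" for k
  proof -
    have "?b k = c k + lower_max r (cut ?b (r - Id) k) k"
      by (rule wfrec[OF wf_strict_partial_order[OF assms]])
    also have "lower_max r (cut ?b (r - Id) k) k = lower_max r ?b k"
      unfolding lower_max_def
      by (intro arg_cong[where f = Max] arg_cong[where f = "insert 0"] image_cong)
        (auto simp: cut_def)
    finally show ?thesis .
  qed
  then show ?thesis by blast
qed

subsection \<open>The chain polytope\<close>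

text \<open>A telescoping bound: each step of the chain raises \<open>b\<close> by at least the next
  entry of \<open>c\<close>. Leaving \<open>b\<close> and \<open>c\<close> general allows its use
  both for transfer images and for small vectors.\<close>

lemma chain_sum_le:
  fixes c b :: "'n \<Rightarrow> real"
  assumes "xs \<noteq> []" "successively (covered_by r) xs"
    and c: "\<And>k. c k \<le> b k" "\<And>l k. (l, k) \<in> r \<Longrightarrow> l \<noteq> k \<Longrightarrow> c k + b l \<le> b k"
  shows "(\<Sum>k\<leftarrow>xs. c k) \<le> b (last xs)"
  using assms(1,2)
proof (induction xs rule: rev_induct)
  case (snoc x xs)
  show ?case
  proof (cases "xs = []")
    case False
    then have "successively (covered_by r) xs" "covered_by r (last xs) x"
      using snoc.prems by (auto simp: successively_append_iff)
    then show ?thesis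
      using snoc.IH[OF False] c(2)[of "last xs" x] by (auto simp: covered_by_def)
  qed (use c in simp)
qed simp

lemma ex_covered_by_above:
  fixes r :: "('n::finite) rel"
  assumes po: "partial_order_on UNIV r" and "(l, k) \<in> r" "l \<noteq> k"
  shows "\<exists>m. (l, m) \<in> r \<and> covered_by r m k"
proof -
  have *: "trans r" "antisym r" "refl r"
    using po by (auto simp: partial_order_on_def preorder_on_def)
  define g where "g m = card {n. (n, m) \<in> r}" for m
  let ?P = "\<lambda>m. (l, m) \<in> r \<and> (m, k) \<in> r \<and> m \<noteq> k"
  \<comment> \<open>Among the elements from \<open>l\<close> up to but excluding \<open>k\<close>,
    one with the most lower bounds has nothing between it and \<open>k\<close>.\<close>
  have "?P l" using assms * by (auto simp: refl_on_def)
  moreover have "\<forall>m. ?P m \<longrightarrow> g m < CARD('n) + 1"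
    by (auto simp: g_def less_Suc_eq_le intro: card_mono)
  ultimately obtain m where m: "?P m" and max: "\<And>n. ?P n \<Longrightarrow> g n \<le> g m"
    using ex_has_greatest_nat[of ?P l g] by blast
  have False if "n \<noteq> m" "n \<noteq> k" "(m, n) \<in> r" "(n, k) \<in> r" for n
  proof -
    have "?P n" using that m *(1) by (auto dest: transD)
    moreover have "g m < g n"
      using card_lower_bounds_strict_mono[OF po that(3)] that(1) by (auto simp: g_def)
    ultimately show False using max[of n] by simp
  qed
  then show ?thesis using m by (auto simp: covered_by_def)
qed

lemma covered_by_converse: "covered_by (r\<inverse>) i j \<longleftrightarrow> covered_by r j i"
  by (auto simp: covered_by_def)

lemma ex_cover_chain_from:
  fixes r :: "('n::finite) rel"
  assumes po: "partial_order_on UNIV r"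
  shows "\<exists>ys. successively (covered_by r) (k # ys) \<and>
    (\<forall>m. (last (k # ys), m) \<in> r \<longrightarrow> m = last (k # ys))"
proof -
  have po': "partial_order_on UNIV (r\<inverse>)" using po by simp
  show ?thesis
  proof (induction k rule: wf_induct_rule[OF wf_strict_partial_order[OF po']])
    case (1 k)
    show ?case
    proof (cases "\<forall>m. (k, m) \<in> r \<longrightarrow> m = k")
      case True
      then show ?thesis by (intro exI[of _ "[]"]) auto
    next
      case False
      then obtain n where "covered_by r k n"
        using ex_covered_by_above[OF po'] covered_by_converse by (metis converse_iff)
      moreover from this obtain ys where "successively (covered_by r) (n # ys)"
        "\<forall>m. (last (n # ys), m) \<in> r \<longrightarrow> m = last (n # ys)"
        using 1[of n] by (auto simp: covered_by_def)
      ultimately show ?thesis by (intro exI[of _ "n # ys"]) auto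
    qed
  qed
qed

text \<open>The reverse estimate to \<open>chain_sum_le\<close>: descending each time to a covered
  element whose \<open>b\<close> is at least the maximum, the increments of \<open>b\<close> along
  the chain are at most the entries of \<open>c\<close>.\<close>

lemma ex_heavy_cover_chain_to:
  fixes r :: "('n::finite) rel" and c b :: "'n \<Rightarrow> real"
  assumes po: "partial_order_on UNIV r" and c: "\<And>k. 0 \<le> c k"
    and b: "\<And>k. b k = c k + lower_max r b k"
  shows "\<exists>xs. successively (covered_by r) (xs @ [k]) \<and>
    (\<forall>m. (m, hd (xs @ [k])) \<in> r \<longrightarrow> m = hd (xs @ [k])) \<and> b k \<le> (\<Sum>l\<leftarrow>xs @ [k]. c l)"
proof (induction k rule: wf_induct_rule[OF wf_strict_partial_order[OF po]])
  case (1 k)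
  have bmono: "b l \<le> b m" if "(l, m) \<in> r" for l m
    using that b[of m] c[of m] lower_max_ge[of l m r b] by (cases "l = m") auto
  show ?case
  proof (cases "\<forall>m. (m, k) \<in> r \<longrightarrow> m = k")
    case True
    then have "lower_max r b k = 0" using lower_max_cases[of r b k] by auto
    then show ?thesis using True b[of k] by (intro exI[of _ "[]"]) auto
  next
    case False
    have "\<exists>l. covered_by r l k \<and> lower_max r b k \<le> b l"
    proof -
      \<comment> \<open>If the maximum is the inserted 0, any element strictly below
        \<open>k\<close> will do, as \<open>b\<close> is nonnegative. Monotonicity of
        \<open>b\<close> then allows passing to an element covered by \<open>k\<close>.\<close>
      obtain l where l: "(l, k) \<in> r" "l \<noteq> k" "lower_max r b k \<le> b l"
        using lower_max_cases[of r b k] False b c lower_max_nonneg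
        by (metis add_nonneg_nonneg order_refl)
      then show ?thesis using ex_covered_by_above[OF po l(1,2)] bmono by (meson order_trans)
    qed
    then obtain l where l: "covered_by r l k" "lower_max r b k \<le> b l" by blast
    then obtain xs where xs: "successively (covered_by r) (xs @ [l])"
      "\<forall>m. (m, hd (xs @ [l])) \<in> r \<longrightarrow> m = hd (xs @ [l])" "b l \<le> (\<Sum>l\<leftarrow>xs @ [l]. c l)"
      using 1[of l] by (auto simp: covered_by_def)
    have "successively (covered_by r) ((xs @ [l]) @ [k])"
      using xs(1) l(1) by (subst successively_append_iff) auto
    moreover have "hd ((xs @ [l]) @ [k]) = hd (xs @ [l])" by (cases xs) auto
    moreover have "b k \<le> (\<Sum>l\<leftarrow>(xs @ [l]) @ [k]. c l)"
      using xs(3) l(2) b[of k] by simp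
    ultimately show ?thesis using xs(2) by (intro exI[of _ "xs @ [l]"]) simp
  qed
qed

text \<open>The heavy chain ending at \<open>k\<close> is prolonged upwards to a maximal chain. The
  extra coordinates are nonnegative, so the chain inequality bounds \<open>b k\<close>.\<close>

lemma transfer_inverse_le_1:
  fixes r :: "('n::finite) rel"
  assumes po: "partial_order_on UNIV r" and c: "c \<in> chain_polytope r"
    and b: "\<And>k. b k = c $ k + lower_max r b k"
  shows "b k \<le> 1"
proof -
  have c0: "0 \<le> c $ l" for l using c by (simp add: chain_polytope_def)
  obtain xs where xs: "successively (covered_by r) (xs @ [k])"
    "\<forall>m. (m, hd (xs @ [k])) \<in> r \<longrightarrow> m = hd (xs @ [k])" "b k \<le> (\<Sum>l\<leftarrow>xs @ [k]. c $ l)"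
    using ex_heavy_cover_chain_to[OF po c0 b] by blast
  obtain ys where ys: "successively (covered_by r) (k # ys)"
    "\<forall>m. (last (k # ys), m) \<in> r \<longrightarrow> m = last (k # ys)"
    using ex_cover_chain_from[OF po] by blast
  have "successively (covered_by r) (xs @ k # ys)"
    using xs(1) ys(1) by (auto simp: successively_append_iff)
  moreover have "hd (xs @ k # ys) = hd (xs @ [k])" by (cases xs) auto
  ultimately have "maximal_chain r (xs @ k # ys)"
    using xs(2) ys(2) by (simp add: maximal_chain_def)
  then have "(\<Sum>l\<leftarrow>xs @ k # ys. c $ l) \<le> 1" using c by (simp only: chain_polytope_def mem_Collect_eq)
  moreover have "0 \<le> (\<Sum>l\<leftarrow>ys. c $ l)" using c0 by (intro sum_list_nonneg) auto
  ultimately show ?thesis using xs(3) by simp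
qed

lemma transfer_in_chain_polytope:
  assumes "\<And>k. lower_max r b k \<le> b k" "\<And>k. b k \<le> 1"
  shows "(\<chi> k. b k - lower_max r b k) \<in> chain_polytope r"
proof -
  have "(\<Sum>k\<leftarrow>xs. b k - lower_max r b k) \<le> 1" if "maximal_chain r xs" for xs
  proof -
    have "(\<Sum>k\<leftarrow>xs. b k - lower_max r b k) \<le> b (last xs)"
      using that lower_max_nonneg[of r b] lower_max_ge[of _ _ r b]
      by (intro chain_sum_le[where r = r]) (auto simp: maximal_chain_def)
    then show ?thesis using assms(2)[of "last xs"] by linarith
  qed
  then show ?thesis using assms(1) by (simp add: chain_polytope_def cong: map_cong)
qed

section \<open>Vertices of the two pieces of the chain polytope\<close>

text \<open>Equal strict lower bounds give equal \<open>lower_max\<close> at \<open>i\<close> and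
  \<open>j\<close>, so the cutting inequality becomes \<open>b i \<le> b j\<close>, which every
  monotone bump preserves.\<close>

lemma extreme_point_of_half_chain_polytope_01:
  fixes r :: "('n::finite) rel"
  assumes po: "partial_order_on UNIV r"
    and low: "{l. (l, i) \<in> r \<and> l \<noteq> i} = {l. (l, j) \<in> r \<and> l \<noteq> j}"
    and v: "v extreme_point_of (chain_polytope r \<inter> {x. x $ i \<le> x $ j})"
  shows "v $ k = 0 \<or> v $ k = 1"
proof -
  have vC: "v \<in> chain_polytope r" and vij: "v $ i \<le> v $ j"
    using v by (auto simp: extreme_point_of_def)
  obtain b where b: "\<And>k. b k = v $ k + lower_max r b k"
    using ex_transfer_inverse[OF po, of "($) v"] by blast
  have lm: "lower_max r b k \<le> b k" for k
    using b[of k] vC by (simp add: chain_polytope_def)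
  have b0: "0 \<le> b k" for k using lm[of k] lower_max_nonneg[of r b k] by linarith
  have b1: "b k \<le> 1" for k by (rule transfer_inverse_le_1[OF po vC b])
  have lmij: "lower_max r f i = lower_max r f j" for f
    using low by (simp add: lower_max_def)
  have b01: "b k = 0 \<or> b k = 1" for k
  proof (rule ccontr)
    assume nk: "\<not> ?thesis"
    define t where "t = b k"
    have t: "0 < t" "t < 1" using nk b0[of k] b1[of k] by (auto simp: t_def)
    define V where "V = range b \<union> {0, 1}"
    have "finite V" by (simp add: V_def)
    then obtain e where e: "e > 0" "mono_on V (bump t e)" "mono_on V (bump t (- e))"
      by (rule bump_mono_on_finite)
    define w where
      "w s = (\<chi> l. bump t s (b l) - lower_max r (\<lambda>m. bump t s (b m)) l)" for s
    have lmb: "lower_max r (\<lambda>m. bump t s (b m)) l = bump t s (lower_max r b l)"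
      if "mono_on V (bump t s)" for s l
      using t by (intro lower_max_comp[OF that]) (auto simp: V_def bump_def)
    have lmV: "lower_max r b l \<in> V" for l
      using lower_max_cases[of r b l] by (auto simp: V_def)
    have wC: "w s \<in> chain_polytope r \<inter> {x. x $ i \<le> x $ j}" if m: "mono_on V (bump t s)" for s
    proof -
      have "bump t s 1 = 1" using t by (simp add: bump_def)
      then have "bump t s (b l) \<le> 1" for l
        using mono_onD[OF m, of "b l" 1] b1[of l] by (auto simp: V_def)
      moreover have "lower_max r (\<lambda>m. bump t s (b m)) l \<le> bump t s (b l)" for l
        using mono_onD[OF m lmV _ lm, of l] lmb[OF m] by (auto simp: V_def)
      ultimately have "w s \<in> chain_polytope r"
        unfolding w_def by (intro transfer_in_chain_polytope)
      moreover have "b i \<le> b j" using b[of i] b[of j] vij lmij[of b] by simp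
      then have "w s $ i \<le> w s $ j"
        using mono_onD[OF m, of "b i" "b j"] by (simp add: w_def lmij V_def)
      ultimately show ?thesis by simp
    qed
    \<comment> \<open>Both \<open>b\<close> and its lower maxima move by the same signed amount
      where they equal \<open>t\<close>, so the bumps by \<open>e\<close> and \<open>- e\<close>
      displace \<open>v\<close> in opposite directions.\<close>
    define d :: "real ^ 'n" where
      "d = (\<chi> l. (if b l = t then e else 0) - (if lower_max r b l = t then e else 0))"
    have vb: "v $ l = b l - lower_max r b l" for l using b[of l] by simp
    have "v + d = w e" "v - d = w (- e)"
      by (simp_all add: vec_eq_iff w_def d_def vb lmb[OF e(2)] lmb[OF e(3)], simp_all add: bump_def)
    then have "d = 0"
      by (intro extreme_point_of_perturb_eq_0[OF v]) (simp_all only: wC[OF e(2)] wC[OF e(3)])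
    \<comment> \<open>At a minimal element of the level set the lower maximum is not
      \<open>t\<close>: it is 0 or a value of \<open>b\<close> strictly below. Hence nothing cancels
      and \<open>d\<close> is nonzero there.\<close>
    moreover obtain l where l: "b l = t" "\<And>m. (m, l) \<in> r - Id \<Longrightarrow> b m \<noteq> t"
      using wfE_min[OF wf_strict_partial_order[OF po], of k "{m. b m = t}"]
      by (auto simp: t_def)
    then have "lower_max r b l \<noteq> t" using lower_max_cases[of r b l] t by auto
    then have "d $ l = e" using l(1) by (simp add: d_def)
    ultimately show False using e(1) by simp
  qed
  \<comment> \<open>A coordinate of \<open>v\<close> is a difference of two 0/1 values, and
    \<open>lm\<close> excludes -1.\<close>
  have "lower_max r b k = 0 \<or> lower_max r b k = 1"
    using lower_max_cases[of r b k] b01 by metis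
  then show ?thesis using b[of k] b01[of k] lm[of k] by auto
qed

lemma chain_polytope_subset_cube:
  fixes r :: "('n::finite) rel"
  assumes po: "partial_order_on UNIV r" and c: "c \<in> chain_polytope r"
  shows "0 \<le> c $ k \<and> c $ k \<le> 1"
proof -
  obtain b where b: "\<And>k. b k = c $ k + lower_max r b k"
    using ex_transfer_inverse[OF po, of "($) c"] by blast
  have "c $ k \<le> b k" using b[of k] lower_max_nonneg[of r b k] by simp
  also have "b k \<le> 1" by (rule transfer_inverse_le_1[OF po c b])
  finally show ?thesis using c by (simp add: chain_polytope_def)
qed

section \<open>The separating hyperplane of the chain polytope\<close>

lemma small_vector_in_chain_polytope:
  fixes r :: "('n::finite) rel"
  assumes po: "partial_order_on UNIV r"
    and x: "\<And>k. 0 \<le> x $ k" "\<And>k. x $ k \<le> 1 / CARD('n)"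
  shows "x \<in> chain_polytope r"
proof -
  have rf: "refl r" using po by (auto simp: partial_order_on_def preorder_on_def)
  \<comment> \<open>This bound grows by at least \<open>1 / CARD('n)\<close> at every strict step
    and never exceeds 1, so chain sums are controlled without estimating chain lengths.\<close>
  define b where "b k = real (card {m. (m, k) \<in> r}) / CARD('n)" for k
  have b1: "b k \<le> 1" for k unfolding b_def by (auto intro!: divide_le_eq_1_pos[THEN iffD2] card_mono)
  have "x $ k \<le> b k" for k
  proof -
    have "k \<in> {m. (m, k) \<in> r}" using rf by (auto simp: refl_on_def)
    then have "0 < card {m. (m, k) \<in> r}" by (intro card_gt_0_iff[THEN iffD2]) auto
    then have "1 \<le> real (card {m. (m, k) \<in> r})" by linarith
    then have "1 / CARD('n) \<le> b k" unfolding b_def by (rule divide_right_mono) simp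
    then show ?thesis using x(2)[of k] by linarith
  qed
  moreover have "x $ k + b l \<le> b k" if "(l, k) \<in> r" "l \<noteq> k" for l k
  proof -
    have "1 + real (card {m. (m, l) \<in> r}) \<le> real (card {m. (m, k) \<in> r})"
      using card_lower_bounds_strict_mono[OF po that] by linarith
    then have "(1 + real (card {m. (m, l) \<in> r})) / CARD('n) \<le> b k"
      unfolding b_def by (rule divide_right_mono) simp
    then have "1 / CARD('n) + b l \<le> b k" by (simp add: b_def add_divide_distrib)
    then show ?thesis using x(2)[of k] by linarith
  qed
  ultimately have "(\<Sum>k\<leftarrow>xs. x $ k) \<le> b (last xs)" if "maximal_chain r xs" for xs
    using that by (intro chain_sum_le[where r = r]) (auto simp: maximal_chain_def)
  then show ?thesis using x(1) b1 by (auto simp: chain_polytope_def intro: order_trans)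
qed

lemma chain_polytope_separating_hyperplane:
  fixes r :: "('n::finite) rel"
  assumes po: "partial_order_on UNIV r" and "i \<noteq> j"
    and low: "{l. (l, i) \<in> r \<and> l \<noteq> i} = {l. (l, j) \<in> r \<and> l \<noteq> j}"
  shows "separating_hyperplane (chain_polytope r) {x. (axis i 1 - axis j 1) \<bullet> x = 0}"
proof -
  define U :: "(real ^ 'n) set" where
    "U = (\<Inter>k. {x. 0 < x $ k} \<inter> {x. x $ k < 1 / CARD('n)})"
  define p :: "real ^ 'n" where "p = (\<chi> k. 1 / (2 * CARD('n)))"
  have "open U" unfolding U_def
    by (intro open_Int open_INT ballI)
      (auto intro!: open_Collect_less continuous_intros)
  moreover have "U \<subseteq> chain_polytope r"
    using small_vector_in_chain_polytope[OF po] unfolding U_def by (auto intro: less_imp_le)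
  ultimately have "U \<subseteq> rel_interior (chain_polytope r)"
    by (meson interior_maximal interior_subset_rel_interior subset_trans)
  moreover have "p \<in> U" by (auto simp: U_def p_def field_simps)
  ultimately have "p \<in> rel_interior (chain_polytope r)" by blast
  moreover have "p $ i - p $ j = 0" by (simp add: p_def)
  \<comment> \<open>Stated for a general pair because the second piece arises by exchanging
    \<open>i\<close> and \<open>j\<close>.\<close>
  moreover have ext: "v extreme_point_of chain_polytope r"
    if v: "v extreme_point_of (chain_polytope r \<inter> {x. x $ k \<le> x $ l})"
      and kl: "{m. (m, k) \<in> r \<and> m \<noteq> k} = {m. (m, l) \<in> r \<and> m \<noteq> l}" for v k l
  proof (rule extreme_point_of_01_vector)
    show "v $ m = 0 \<or> v $ m = 1" for m
      by (rule extreme_point_of_half_chain_polytope_01[OF po kl v])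
    show "v \<in> chain_polytope r" using v by (auto simp: extreme_point_of_def)
  qed (rule chain_polytope_subset_cube[OF po])
  ultimately show ?thesis
    unfolding separating_hyperplane_def
    using ext[OF _ low] ext[OF _ low[symmetric]]
    by (intro exI[of _ "axis i 1 - axis j 1"] exI[of _ 0] conjI axis_diff_nonzero \<open>i \<noteq> j\<close> refl)
      (auto simp: inner_axis_diff)
qed

text \<open>Take an incomparable pair with the fewest lower bounds in total. If \<open>l\<close>
  lies strictly below \<open>i\<close>, then \<open>l\<close> and \<open>j\<close> are comparable by
  minimality; \<open>j\<close> below \<open>l\<close> would put \<open>j\<close> below
  \<open>i\<close>, so \<open>l\<close> lies strictly below \<open>j\<close>. The other inclusion is
  symmetric.\<close>

lemma ex_incomparable_same_lower_bounds:
  fixes r :: "('n::finite) rel"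
  assumes po: "partial_order_on UNIV r" and "UNIV \<notin> Chains r"
  obtains i j where "(i, j) \<notin> r" "(j, i) \<notin> r"
    "{l. (l, i) \<in> r \<and> l \<noteq> i} = {l. (l, j) \<in> r \<and> l \<noteq> j}"
proof -
  have tr: "trans r" using po by (auto simp: partial_order_on_def preorder_on_def)
  define g where "g k = card {m. (m, k) \<in> r}" for k
  have g: "g k < g l" if "(k, l) \<in> r" "k \<noteq> l" for k l
    unfolding g_def by (rule card_lower_bounds_strict_mono[OF po that])
  let ?inc = "\<lambda>(i, j). (i, j) \<notin> r \<and> (j, i) \<notin> r"
  obtain q where "?inc q" using assms(2) by (auto simp: Chains_def)
  then obtain i j where ij: "(i, j) \<notin> r" "(j, i) \<notin> r"
    and min: "\<And>k l. (k, l) \<notin> r \<Longrightarrow> (l, k) \<notin> r \<Longrightarrow> g i + g j \<le> g k + g l"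
    using ex_has_least_nat[of ?inc q "\<lambda>(i, j). g i + g j"] by (auto simp: split_beta)
  have "(l, j) \<in> r \<and> l \<noteq> j" if "(l, i) \<in> r" "l \<noteq> i" for l
    using min[of l j] g[OF that] ij transD[OF tr _ that(1), of j] that(1) by fastforce
  moreover have "(l, i) \<in> r \<and> l \<noteq> i" if "(l, j) \<in> r" "l \<noteq> j" for l
    using min[of i l] g[OF that] ij transD[OF tr _ that(1), of i] that(1) by fastforce
  ultimately show thesis using that[OF ij] by blast
qed

theorem theorem2p6:
  fixes r :: "('n::finite) rel"
  assumes "partial_order_on UNIV r"
    and "UNIV \<notin> Chains r"
  shows "(\<exists>H. separating_hyperplane (order_polytope r) H) \<and>
         (\<exists>H. separating_hyperplane (chain_polytope r) H)"
proof -
  obtain i j where ij: "(i, j) \<notin> r" "(j, i) \<notin> r"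
    and low: "{l. (l, i) \<in> r \<and> l \<noteq> i} = {l. (l, j) \<in> r \<and> l \<noteq> j}"
    using ex_incomparable_same_lower_bounds[OF assms] by blast
  have "i \<noteq> j"
    using assms(1) ij by (auto simp: partial_order_on_def preorder_on_def refl_on_def)
  then show ?thesis
    using order_polytope_separating_hyperplane[OF assms(1) ij]
      chain_polytope_separating_hyperplane[OF assms(1) _ low] by blast
qed

end
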